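(* Let an $N$-player linear-quadratic generalized Nash game with shared affine constraints be given as in the context, with monotone pseudogradient $\phi(x)=Fx+f$. Assume that the quadratic program (QP) of the context has a solution $z^\star$ with optimal value $0$ (equivalently, that the game has a v-GNE). Let $\gamma>0$, let $z^0\in\mathbb{R}^{n+m+q}$, and let $z^k=(x^k,\lambda^k,\nu^k)$, $k\ge 1$, be the iterates of the accelerated proximal-point procedure described in the context with constant proximal parameter $\gamma_k=\gamma$ for all $k$. Then $x^k$ is an $\mathcal{O}(1/k^2)$-approximated generalized Nash equilibrium of the game, i.e. there is a constant $C\ge 0$ independent of $k$ such that for every $k\ge 1$ the point $x^k$ is a $(C/k^2)$-approximated generalized Nash equilibrium.
   Context: Game. There are $N$ players; player $i\in\{1,\dots,N\}$ chooses $x_i\in\mathbb{R}^{n_i}$, and $x=(x_1,\dots,x_N)\in\mathbb{R}^n$, $n=\sum_i n_i$; $x_{-i}$ denotes all components of $x$ other than $x_i$, and $x=(x_i,x_{-i})$. Player $i$ minimizes over $x_i$ the cost $J_i(x)=\tfrac12 x^\top Q^{(i)}x+(c^{(i)})^\top x$, with $Q^{(i)}\in\mathbb{R}^{n\times n}$ symmetric and $c^{(i)}\in\mathbb{R}^n$, subject to the shared constraint $x\in\mathcal{X}=\{x\in\mathbb{R}^n: Ax\le b,\ Ex=e\}$, where $A\in\mathbb{R}^{m\times n}$, $b\in\mathbb{R}^m$, $E\in\mathbb{R}^{q\times n}$, $e\in\mathbb{R}^q$, $m,q\ge 0$. Vector inequalities are componentwise; $\|\cdot\|$ is the Euclidean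 norm. Pseudogradient. $\phi(x)=Fx+f$, obtained by stacking $\nabla_{x_i}J_i(x)$, i.e. the $i$-th block of rows of $F\in\mathbb{R}^{n\times n}$ (the $n_i$ rows indexed by the coordinates of $x_i$) equals the $i$-th block of rows of $Q^{(i)}$, and the $i$-th block of $f\in\mathbb{R}^n$ equals the $i$-th block of $c^{(i)}$. Put $F_s=\tfrac12(F+F^\top)$. Standing assumption. $\phi$ is monotone: $(\phi(x)-\phi(y))^\top(x-y)\ge 0$ for all $x,y\in\mathbb{R}^n$ (equivalently $F_s\succeq 0$). v-GNE. A v-GNE is a point $x^\star\in\mathcal{X}$ with $\phi(x^\star)^\top(y-x^\star)\ge0$ for all $y\in\mathcal{X}$. $\varepsilon$-approximated GNE. A point $x^\varepsilon\in\mathcal{X}$ is an $\varepsilon$-approximated generalized Nash equilibrium if for every player $i$ and every $z_i\in\mathbb{R}^{n_i}$ with $(z_i,x^\varepsilon_{-i})\in\mathcal{X}$ one has $J_i(x_i^\varepsilon,x_{-i}^\varepsilon)\le J_i(z_i,x_{-i}^\varepsilon)+\varepsilon$. The quadratic program (QP). Minimize $x^\top F_sx+f^\top x+b^\top\lambda+e^\top\nu$ over $z=(x,\lambda,\nu)\in\mathbb{R}^{n+m+q}$ in the feasible set $\mathcal{Z}=\{(x,\lambda,\nu): Fx+f+A^\top\lambda+E^\top\nu=0,\ Ex=e,\ Ax\le b,\ \lambda\ge0\}$. Accelerated proximal-point procedure. Let $\Psi(z)=x^\top F_sx+f^\top x+b^\top\lambda+e^\top\nu$ for $z\in\mathcal{Z}$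 and $\Psi(z)=+\infty$ otherwise. Given $z^0$, proximal parameters $\gamma_k>0$ and $\theta_0=1$, set $z^1=\arg\min_z\{\Psi(z)+\tfrac{1}{2\gamma_0}\|z-z^0\|^2\}$, and for $k=1,2,\dots$: let $\theta_k\in(0,1]$ be the solution of $\theta_k^2/\gamma_k=(1-\theta_k)\,\theta_{k-1}^2/\gamma_{k-1}$; set $y^k=z^k+\theta_k\bigl(\tfrac{1}{\theta_{k-1}}-1\bigr)(z^k-z^{k-1})$; set $z^{k+1}=\arg\min_z\{\Psi(z)+\tfrac{1}{2\gamma_k}\|z-y^k\|^2\}$. *)

theory Defs
  imports "Jordan_Normal_Form.Matrix" "HOL-Library.Extended_Real"
begin

text \<open>
  Vectors and matrices are those of \<open>Jordan_Normal_Form\<close>, so every dimension is a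
  natural number and may be \<open>0\<close>; in particular the inequality or equality constraints may be
  absent. Players and coordinates are numbered from \<open>0\<close>. The order on vectors is componentwise.
\<close>

definition enorm :: "real vec \<Rightarrow> real" where
  "enorm v = sqrt (v \<bullet> v)"

section \<open>Linear-quadratic games with shared affine constraints\<close>

record lq_game =
  players :: nat                         (* N *)
  sdim :: "nat \<Rightarrow> nat"                 (* n_i, relevant for i < N *)
  costQ :: "nat \<Rightarrow> real mat"           (* Q^(i), relevant for i < N *)
  costc :: "nat \<Rightarrow> real vec"           (* c^(i), relevant for i < N *)
  ineqA :: "real mat"
  ineqb :: "real vec"
  eqE :: "real mat"
  eqe :: "real vec"

definition offset :: "lq_game \<Rightarrow> nat \<Rightarrow> nat" where
  "offset G i = (\<Sum>j<i. sdim G j)"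

definition tdim :: "lq_game \<Rightarrow> nat" where
  "tdim G = (\<Sum>j<players G. sdim G j)"

definition num_ineq :: "lq_game \<Rightarrow> nat" where
  "num_ineq G = dim_row (ineqA G)"

definition num_eq :: "lq_game \<Rightarrow> nat" where
  "num_eq G = dim_row (eqE G)"

definition wf_lq_game :: "lq_game \<Rightarrow> bool" where
  "wf_lq_game G \<longleftrightarrow>
     (\<forall>i<players G. costQ G i \<in> carrier_mat (tdim G) (tdim G) \<and>
        transpose_mat (costQ G i) = costQ G i \<and> costc G i \<in> carrier_vec (tdim G)) \<and>
     ineqA G \<in> carrier_mat (num_ineq G) (tdim G) \<and> ineqb G \<in> carrier_vec (num_ineq G) \<and>
     eqE G \<in> carrier_mat (num_eq G) (tdim G) \<and> eqe G \<in> carrier_vec (num_eq G)"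

definition cost :: "lq_game \<Rightarrow> nat \<Rightarrow> real vec \<Rightarrow> real" where
  "cost G i x = 1 / 2 * (x \<bullet> (costQ G i *\<^sub>v x)) + costc G i \<bullet> x"

definition feas :: "lq_game \<Rightarrow> real vec set" where
  "feas G = {x \<in> carrier_vec (tdim G). ineqA G *\<^sub>v x \<le> ineqb G \<and> eqE G *\<^sub>v x = eqe G}"

text \<open>\<open>deviate G i u x\<close> is the profile \<open>(u, x\<^bsub>-i\<^esub>)\<close>.\<close>

definition deviate :: "lq_game \<Rightarrow> nat \<Rightarrow> real vec \<Rightarrow> real vec \<Rightarrow> real vec" where
  "deviate G i u x = vec (tdim G)
     (\<lambda>r. if offset G i \<le> r \<and> r < offset G (Suc i) then u $ (r - offset G i) else x $ r)"

definition approx_GNE :: "lq_game \<Rightarrow> real \<Rightarrow> real vec \<Rightarrow> bool" where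
  "approx_GNE G \<epsilon> x \<longleftrightarrow> x \<in> feas G \<and>
     (\<forall>i<players G. \<forall>u\<in>carrier_vec (sdim G i).
        deviate G i u x \<in> feas G \<longrightarrow> cost G i x \<le> cost G i (deviate G i u x) + \<epsilon>)"

text \<open>The player controlling coordinate \<open>r\<close>; blocks are consecutive.\<close>

definition owner :: "lq_game \<Rightarrow> nat \<Rightarrow> nat" where
  "owner G r = (LEAST i. r < offset G (Suc i))"

definition pgF :: "lq_game \<Rightarrow> real mat" where
  "pgF G = mat (tdim G) (tdim G) (\<lambda>(r, s). costQ G (owner G r) $$ (r, s))"

definition pgf :: "lq_game \<Rightarrow> real vec" where
  "pgf G = vec (tdim G) (\<lambda>r. costc G (owner G r) $ r)"

definition pseudograd :: "lq_game \<Rightarrow> real vec \<Rightarrow> real vec" where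
  "pseudograd G x = pgF G *\<^sub>v x + pgf G"

definition pgFs :: "lq_game \<Rightarrow> real mat" where
  "pgFs G = (1 / 2) \<cdot>\<^sub>m (pgF G + transpose_mat (pgF G))"

definition monotone_pseudograd :: "lq_game \<Rightarrow> bool" where
  "monotone_pseudograd G \<longleftrightarrow>
     (\<forall>x\<in>carrier_vec (tdim G). \<forall>y\<in>carrier_vec (tdim G).
        (pseudograd G x - pseudograd G y) \<bullet> (x - y) \<ge> 0)"

lemma owner_block:
  assumes "offset G i \<le> r" "r < offset G (Suc i)"
  shows "owner G r = i"
  unfolding owner_def
proof (rule Least_equality)
  fix j assume j: "r < offset G (Suc j)"
  show "i \<le> j"
  proof (rule ccontr)
    assume "\<not> i \<le> j"
    then have "offset G (Suc j) \<le> offset G i"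
      unfolding offset_def by (intro sum_mono2) auto
    with assms(1) j show False by simp
  qed
qed (rule assms(2))

lemma pseudograd_block_rows:
  assumes "wf_lq_game G" "i < players G" "offset G i \<le> r" "r < offset G (Suc i)"
  shows "row (pgF G) r = row (costQ G i) r" and "pgf G $ r = costc G i $ r"
proof -
  have "offset G (Suc i) \<le> tdim G"
    unfolding offset_def tdim_def using assms(2) by (intro sum_mono2) auto
  with assms(4) have "r < tdim G" by simp
  moreover have "costQ G i \<in> carrier_mat (tdim G) (tdim G)"
    using assms(1,2) by (simp add: wf_lq_game_def)
  ultimately show "row (pgF G) r = row (costQ G i) r" and "pgf G $ r = costc G i $ r"
    by (auto simp: pgF_def pgf_def owner_block[OF assms(3,4)])
qed

section \<open>The quadratic program\<close>

text \<open>The variable is the concatenation \<open>z = (x, \<lambda>, \<nu>)\<close>, a vector of dimension \<open>n + m + q\<close>.\<close>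

definition qp_dim :: "lq_game \<Rightarrow> nat" where
  "qp_dim G = tdim G + num_ineq G + num_eq G"

definition xpart :: "lq_game \<Rightarrow> real vec \<Rightarrow> real vec" where
  "xpart G z = vec_first z (tdim G)"

definition lampart :: "lq_game \<Rightarrow> real vec \<Rightarrow> real vec" where
  "lampart G z = vec_last (vec_first z (tdim G + num_ineq G)) (num_ineq G)"

definition nupart :: "lq_game \<Rightarrow> real vec \<Rightarrow> real vec" where
  "nupart G z = vec_last z (num_eq G)"

lemma parts_append:
  assumes "x \<in> carrier_vec (tdim G)" "l \<in> carrier_vec (num_ineq G)" "v \<in> carrier_vec (num_eq G)"
  shows "xpart G (x @\<^sub>v l @\<^sub>v v) = x" "lampart G (x @\<^sub>v l @\<^sub>v v) = l"
    "nupart G (x @\<^sub>v l @\<^sub>v v) = v"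
  using assms
  by (auto simp: xpart_def lampart_def nupart_def vec_first_def vec_last_def append_vec_def
      Let_def intro!: eq_vecI)

definition qp_obj :: "lq_game \<Rightarrow> real vec \<Rightarrow> real" where
  "qp_obj G z = xpart G z \<bullet> (pgFs G *\<^sub>v xpart G z) + pgf G \<bullet> xpart G z
     + ineqb G \<bullet> lampart G z + eqe G \<bullet> nupart G z"

definition qp_feas :: "lq_game \<Rightarrow> real vec set" where
  "qp_feas G = {z \<in> carrier_vec (qp_dim G).
     pgF G *\<^sub>v xpart G z + pgf G + transpose_mat (ineqA G) *\<^sub>v lampart G z
       + transpose_mat (eqE G) *\<^sub>v nupart G z = 0\<^sub>v (tdim G) \<and>
     eqE G *\<^sub>v xpart G z = eqe G \<and> ineqA G *\<^sub>v xpart G z \<le> ineqb G \<and>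
     0\<^sub>v (num_ineq G) \<le> lampart G z}"

definition qp_solution :: "lq_game \<Rightarrow> real vec \<Rightarrow> bool" where
  "qp_solution G z \<longleftrightarrow> is_arg_min (qp_obj G) (\<lambda>w. w \<in> qp_feas G) z"

section \<open>The accelerated proximal-point procedure\<close>

definition Psi :: "lq_game \<Rightarrow> real vec \<Rightarrow> ereal" where
  "Psi G z = (if z \<in> qp_feas G then ereal (qp_obj G z) else \<infinity>)"

definition is_prox :: "lq_game \<Rightarrow> real \<Rightarrow> real vec \<Rightarrow> real vec \<Rightarrow> bool" where
  "is_prox G g y w \<longleftrightarrow>
     is_arg_min (\<lambda>z. Psi G z + ereal (1 / (2 * g) * (enorm (z - y))\<^sup>2))
       (\<lambda>z. z \<in> carrier_vec (qp_dim G)) w"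

definition accel_ppa ::
  "lq_game \<Rightarrow> (nat \<Rightarrow> real) \<Rightarrow> (nat \<Rightarrow> real) \<Rightarrow> (nat \<Rightarrow> real vec) \<Rightarrow> (nat \<Rightarrow> real vec) \<Rightarrow> bool" where
  "accel_ppa G g \<theta> y z \<longleftrightarrow>
     (\<forall>k. g k > 0) \<and> z 0 \<in> carrier_vec (qp_dim G) \<and> \<theta> 0 = 1 \<and> is_prox G (g 0) (z 0) (z 1) \<and>
     (\<forall>k\<ge>1. 0 < \<theta> k \<and> \<theta> k \<le> 1 \<and>
        (\<theta> k)\<^sup>2 / g k = (1 - \<theta> k) * (\<theta> (k - 1))\<^sup>2 / g (k - 1) \<and>
        y k = z k + (\<theta> k * (1 / \<theta> (k - 1) - 1)) \<cdot>\<^sub>v (z k - z (k - 1)) \<and>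
        is_prox G (g k) (y k) (z (k + 1)))"

end

theory Submission
  imports Defs
begin

text \<open>
  For a feasible point \<open>z = (x, \<lambda>, \<nu>)\<close> of the quadratic program, stationarity and the
  constraints give \<open>\<phi>(x) \<bullet> (x - x') \<le> \<Psi>(z)\<close> for every \<open>x' \<in> \<X>\<close>; since each
  player's cost is convex in that player's own variables, no player can gain more than \<open>\<Psi>(z)\<close> by a
  unilateral deviation. It remains to bound \<open>\<Psi>(z\<^sup>k)\<close>. With
  \<open>u\<^sup>k = z\<^sup>k + (1/\<theta>\<^bsub>k-1\<^esub> - 1)(z\<^sup>k - z\<^sup>k\<^sup>-\<^sup>1)\<close>, the prox inequality tested at
  \<open>(1 - \<theta>\<^sub>k) z\<^sup>k + \<theta>\<^sub>k z\<^sup>\<star>\<close> shows that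
  \<open>\<Psi>(z\<^sup>k)/\<theta>\<^bsub>k-1\<^esub>\<^sup>2 + \<parallel>z\<^sup>\<star> - u\<^sup>k\<parallel>\<^sup>2/(2\<gamma>)\<close> is nonincreasing, and the recursion for
  \<open>\<theta>\<close> forces \<open>1/\<theta>\<close> to grow by at least \<open>1/2\<close> in each step.
\<close>

section \<open>Algebra of linear combinations, quadratic forms and the Euclidean norm\<close>

lemma mult_mat_vec_lincomb:
  fixes M :: "'a::field mat"
  assumes "M \<in> carrier_mat m n" "a \<in> carrier_vec n" "b \<in> carrier_vec n"
  shows "M *\<^sub>v (s \<cdot>\<^sub>v a + t \<cdot>\<^sub>v b) = s \<cdot>\<^sub>v (M *\<^sub>v a) + t \<cdot>\<^sub>v (M *\<^sub>v b)"
  using assms by (simp add: mult_add_distrib_mat_vec[OF assms(1)]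
      mult_mat_vec[OF assms(1,2)] mult_mat_vec[OF assms(1,3)])

lemma scalar_prod_lincomb:
  fixes c :: "'a::comm_ring_1 vec"
  assumes "c \<in> carrier_vec n" "a \<in> carrier_vec n" "b \<in> carrier_vec n"
  shows "c \<bullet> (s \<cdot>\<^sub>v a + t \<cdot>\<^sub>v b) = s * (c \<bullet> a) + t * (c \<bullet> b)"
    and "(s \<cdot>\<^sub>v a + t \<cdot>\<^sub>v b) \<bullet> c = s * (a \<bullet> c) + t * (b \<bullet> c)"
  using assms
  by (simp_all add: scalar_prod_add_distrib[OF assms(1)] add_scalar_prod_distrib[of _ n])

text \<open>Bilinear expansion, kept as an exact identity. For a positive semidefinite
  \<open>M\<close> the last term has a sign and gives convexity; for the identity matrix it is the
  strong convexity of the squared norm.\<close>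

lemma quadratic_form_convex_comb:
  fixes M :: "real mat"
  assumes M: "M \<in> carrier_mat n n" and x: "x \<in> carrier_vec n" and y: "y \<in> carrier_vec n"
  shows "((1 - t) \<cdot>\<^sub>v x + t \<cdot>\<^sub>v y) \<bullet> (M *\<^sub>v ((1 - t) \<cdot>\<^sub>v x + t \<cdot>\<^sub>v y)) =
    (1 - t) * (x \<bullet> (M *\<^sub>v x)) + t * (y \<bullet> (M *\<^sub>v y)) - t * (1 - t) * ((x - y) \<bullet> (M *\<^sub>v (x - y)))"
proof -
  have d: "x - y = 1 \<cdot>\<^sub>v x + (-1) \<cdot>\<^sub>v y"
    using x y by (intro eq_vecI) auto
  have c: "M *\<^sub>v x \<in> carrier_vec n" "M *\<^sub>v y \<in> carrier_vec n"
    using M x y by auto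
  have e: "(s \<cdot>\<^sub>v x + r \<cdot>\<^sub>v y) \<bullet> (M *\<^sub>v (s \<cdot>\<^sub>v x + r \<cdot>\<^sub>v y)) =
      s * s * (x \<bullet> (M *\<^sub>v x)) + s * r * (x \<bullet> (M *\<^sub>v y)) + r * s * (y \<bullet> (M *\<^sub>v x)) + r * r * (y \<bullet> (M *\<^sub>v y))"
    for s r
    unfolding mult_mat_vec_lincomb[OF M x y]
    by (subst scalar_prod_lincomb(2)[where n = n])
      (use x y c in \<open>auto simp: scalar_prod_lincomb(1)[where n = n] algebra_simps\<close>)
  show ?thesis
    unfolding d e by (simp add: algebra_simps)
qed

lemma enorm_sq: "(enorm v)\<^sup>2 = v \<bullet> v"
  by (simp add: enorm_def scalar_prod_def sum_nonneg)

lemma enorm_smult_sq: "(enorm (s \<cdot>\<^sub>v v))\<^sup>2 = s\<^sup>2 * (enorm v)\<^sup>2"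
  unfolding enorm_sq by (simp add: power2_eq_square)

lemma enorm_convex_comb_sq:
  assumes "x \<in> carrier_vec n" "y \<in> carrier_vec n"
  shows "(enorm ((1 - t) \<cdot>\<^sub>v x + t \<cdot>\<^sub>v y))\<^sup>2 =
    (1 - t) * (enorm x)\<^sup>2 + t * (enorm y)\<^sup>2 - t * (1 - t) * (enorm (x - y))\<^sup>2"
  using quadratic_form_convex_comb[OF one_carrier_mat assms] assms by (simp add: enorm_sq)

lemma scalar_prod_mono_left:
  fixes l :: "real vec"
  assumes "l \<in> carrier_vec m" "a \<le> b" "b \<in> carrier_vec m" "0\<^sub>v m \<le> l"
  shows "l \<bullet> a \<le> l \<bullet> b"
  using assms by (auto simp: scalar_prod_def less_eq_vec_def intro!: sum_mono mult_left_mono)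


section \<open>The quadratic program bounds the deviation gains\<close>

lemma part_carriers:
  "xpart G z \<in> carrier_vec (tdim G)" "lampart G z \<in> carrier_vec (num_ineq G)"
  "nupart G z \<in> carrier_vec (num_eq G)"
  by (simp_all add: xpart_def lampart_def nupart_def)

lemma part_lincomb:
  assumes "v \<in> carrier_vec (qp_dim G)" "w \<in> carrier_vec (qp_dim G)"
  shows "xpart G (s \<cdot>\<^sub>v v + t \<cdot>\<^sub>v w) = s \<cdot>\<^sub>v xpart G v + t \<cdot>\<^sub>v xpart G w"
    and "lampart G (s \<cdot>\<^sub>v v + t \<cdot>\<^sub>v w) = s \<cdot>\<^sub>v lampart G v + t \<cdot>\<^sub>v lampart G w"
    and "nupart G (s \<cdot>\<^sub>v v + t \<cdot>\<^sub>v w) = s \<cdot>\<^sub>v nupart G v + t \<cdot>\<^sub>v nupart G w"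
  using assms
  by (auto simp: xpart_def lampart_def nupart_def vec_first_def vec_last_def qp_dim_def
      intro!: eq_vecI)

text \<open>A feasible competitor \<open>v\<close> makes the minimum finite. Hence the minimizer
  \<open>w\<close> cannot lie where \<open>Psi\<close> is infinite, and the extended-real comparison
  becomes one between reals.\<close>

lemma is_prox_le:
  assumes prox: "is_prox G g y w" and v: "v \<in> qp_feas G"
  shows "w \<in> qp_feas G"
    and "qp_obj G w + 1 / (2 * g) * (enorm (w - y))\<^sup>2 \<le> qp_obj G v + 1 / (2 * g) * (enorm (v - y))\<^sup>2"
proof -
  have "v \<in> carrier_vec (qp_dim G)"
    using v by (simp add: qp_feas_def)
  with prox have le: "Psi G w + ereal (1 / (2 * g) * (enorm (w - y))\<^sup>2)
      \<le> Psi G v + ereal (1 / (2 * g) * (enorm (v - y))\<^sup>2)"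
    unfolding is_prox_def is_arg_min_linorder by blast
  with v show w: "w \<in> qp_feas G"
    by (auto simp: Psi_def split: if_splits)
  with le v show "qp_obj G w + 1 / (2 * g) * (enorm (w - y))\<^sup>2
      \<le> qp_obj G v + 1 / (2 * g) * (enorm (v - y))\<^sup>2"
    by (simp add: Psi_def)
qed

context
  fixes G :: lq_game
  assumes wf: "wf_lq_game G" and mono: "monotone_pseudograd G"
begin

lemma game_carriers:
  "pgF G \<in> carrier_mat (tdim G) (tdim G)" "pgFs G \<in> carrier_mat (tdim G) (tdim G)"
  "pgf G \<in> carrier_vec (tdim G)"
  "ineqA G \<in> carrier_mat (num_ineq G) (tdim G)" "ineqb G \<in> carrier_vec (num_ineq G)"
  "eqE G \<in> carrier_mat (num_eq G) (tdim G)" "eqe G \<in> carrier_vec (num_eq G)"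
  using wf by (auto simp: wf_lq_game_def pgF_def pgFs_def pgf_def)

text \<open>A scalar equals its transpose, so symmetrizing the matrix leaves its quadratic form
  unchanged.\<close>

lemma pgFs_quadratic:
  assumes x: "x \<in> carrier_vec (tdim G)"
  shows "x \<bullet> (pgFs G *\<^sub>v x) = x \<bullet> (pgF G *\<^sub>v x)"
proof -
  note F = game_carriers(1)
  have "pgFs G *\<^sub>v x = (1 / 2) \<cdot>\<^sub>v (pgF G *\<^sub>v x + transpose_mat (pgF G) *\<^sub>v x)"
    unfolding pgFs_def using F x
    by (subst add_mult_distrib_mat_vec[of "pgF G" "tdim G" "tdim G", symmetric]) (auto intro!: eq_vecI)
  moreover have "x \<bullet> (transpose_mat (pgF G) *\<^sub>v x) = (pgF G *\<^sub>v x) \<bullet> x"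
    using transpose_vec_mult_scalar[OF F x x] x F by (metis comm_scalar_prod mult_mat_vec_carrier transpose_carrier_mat)
  ultimately show ?thesis
    using F x comm_scalar_prod[of x "tdim G" "pgF G *\<^sub>v x"]
    by (simp add: scalar_prod_add_distrib[of x "tdim G"])
qed

text \<open>Monotonicity applied to \<open>x\<close> and the origin; the constant
  \<open>pgf G\<close> cancels.\<close>

lemma pgF_nonneg:
  assumes x: "x \<in> carrier_vec (tdim G)"
  shows "0 \<le> x \<bullet> (pgF G *\<^sub>v x)"
proof -
  have "pseudograd G x - pseudograd G (0\<^sub>v (tdim G)) = pgF G *\<^sub>v x"
    using x game_carriers(1,3) by (intro eq_vecI) (auto simp: pseudograd_def)
  moreover have "0 \<le> (pseudograd G x - pseudograd G (0\<^sub>v (tdim G))) \<bullet> (x - 0\<^sub>v (tdim G))"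
    using mono x unfolding monotone_pseudograd_def by (metis zero_carrier_vec)
  moreover have "x - 0\<^sub>v (tdim G) = x"
    using x by (intro eq_vecI) auto
  ultimately show ?thesis
    using comm_scalar_prod[of x "tdim G" "pgF G *\<^sub>v x"] x game_carriers(1) by auto
qed

text \<open>The difference \<open>d\<close> is supported on the block of player \<open>i\<close>,
  where \<open>pgF G\<close> and \<open>costQ G i\<close> have the same rows. So the curvature of
  the cost along \<open>d\<close> is that of \<open>pgF G\<close>, which is nonnegative even if
  \<open>costQ G i\<close> is indefinite, and the cost lies above its tangent at \<open>x\<close> in
  this direction.\<close>

lemma cost_deviate_ge:
  assumes i: "i < players G" and x: "x \<in> carrier_vec (tdim G)"
  shows "cost G i x \<le> cost G i (deviate G i u x) + pseudograd G x \<bullet> (x - deviate G i u x)"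
proof -
  let ?n = "tdim G"
  define d where "d = x - deviate G i u x"
  have x': "deviate G i u x \<in> carrier_vec ?n" by (simp add: deviate_def)
  have d: "d \<in> carrier_vec ?n" using x x' by (auto simp: d_def)
  have Q: "costQ G i \<in> carrier_mat ?n ?n" and c: "costc G i \<in> carrier_vec ?n"
    and sym: "transpose_mat (costQ G i) = costQ G i"
    using wf i by (auto simp: wf_lq_game_def)
  note F = game_carriers(1) and f = game_carriers(3)
  have outside: "d $ r = 0" if "r < ?n" "\<not> (offset G i \<le> r \<and> r < offset G (Suc i))" for r
    using that x by (auto simp: d_def deviate_def)
  \<comment> \<open>The scalar \<open>s\<close> lets one identity serve twice: \<open>s = 0\<close>
    gives the curvature term, \<open>s = 1\<close> the pseudogradient.\<close>
  have block: "d \<bullet> (pgF G *\<^sub>v w + s \<cdot>\<^sub>v pgf G) = d \<bullet> (costQ G i *\<^sub>v w + s \<cdot>\<^sub>v costc G i)" for w s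
    unfolding scalar_prod_def
  proof (rule sum.cong)
    fix r assume "r \<in> {0..<dim_vec (costQ G i *\<^sub>v w + s \<cdot>\<^sub>v costc G i)}"
    then have r: "r < ?n" using c by simp
    show "d $ r * (pgF G *\<^sub>v w + s \<cdot>\<^sub>v pgf G) $ r = d $ r * (costQ G i *\<^sub>v w + s \<cdot>\<^sub>v costc G i) $ r"
      using outside[OF r] pseudograd_block_rows[OF wf i, of r] r F f Q c
      by (cases "offset G i \<le> r \<and> r < offset G (Suc i)") auto
  qed (use f c in simp)
  have quad: "0 \<le> d \<bullet> (costQ G i *\<^sub>v d)"
    using block[of d 0] pgF_nonneg[OF d] F Q f c d
    by (simp add: scalar_prod_add_distrib[of d ?n])
  have lin: "pseudograd G x \<bullet> d = d \<bullet> (costQ G i *\<^sub>v x) + costc G i \<bullet> d"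
    using block[of x 1] F Q f c d x comm_scalar_prod[of d ?n "pseudograd G x"] comm_scalar_prod[OF c d]
    by (simp add: pseudograd_def scalar_prod_add_distrib[of d ?n])
  have x'_eq: "deviate G i u x = 1 \<cdot>\<^sub>v x + (- 1) \<cdot>\<^sub>v d"
    using x x' by (intro eq_vecI) (auto simp: d_def)
  have Qx: "costQ G i *\<^sub>v x \<in> carrier_vec ?n" "costQ G i *\<^sub>v d \<in> carrier_vec ?n"
    using Q x d by auto
  have swap: "x \<bullet> (costQ G i *\<^sub>v d) = d \<bullet> (costQ G i *\<^sub>v x)"
    using transpose_vec_mult_scalar[OF Q d x] sym comm_scalar_prod[OF d Qx(1)] by simp
  have "cost G i (deviate G i u x) = cost G i x - d \<bullet> (costQ G i *\<^sub>v x) - costc G i \<bullet> d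
      + 1 / 2 * (d \<bullet> (costQ G i *\<^sub>v d))"
    unfolding cost_def x'_eq mult_mat_vec_lincomb[OF Q x d] scalar_prod_lincomb(1)[OF c x d]
    by (subst scalar_prod_lincomb(2)[where n = ?n])
      (use x d Qx swap in \<open>auto simp: scalar_prod_add_distrib[of _ ?n] algebra_simps\<close>)
  with quad lin show ?thesis
    by (simp add: d_def)
qed

text \<open>A weak duality argument: pairing stationarity with \<open>x'\<close> replaces the
  negative of \<open>pseudograd G x \<bullet> x'\<close> by multiplier terms. The inequality part is
  at most \<open>ineqb G \<bullet> l\<close> because \<open>l\<close> is nonnegative, and the
  equality part is exact.\<close>

lemma pseudograd_gap_le_qp_obj:
  assumes z: "z \<in> qp_feas G" and x': "x' \<in> feas G"
  shows "pseudograd G (xpart G z) \<bullet> (xpart G z - x') \<le> qp_obj G z"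
proof -
  let ?n = "tdim G" let ?x = "xpart G z" let ?l = "lampart G z" let ?v = "nupart G z"
  let ?p = "pseudograd G ?x"
  let ?a = "transpose_mat (ineqA G) *\<^sub>v ?l" let ?b = "transpose_mat (eqE G) *\<^sub>v ?v"
  note C = game_carriers and P = part_carriers[of G z]
  have x'c: "x' \<in> carrier_vec ?n" and Ax': "ineqA G *\<^sub>v x' \<le> ineqb G" and Ex': "eqE G *\<^sub>v x' = eqe G"
    using x' by (auto simp: feas_def)
  have l: "0\<^sub>v (num_ineq G) \<le> ?l" and stat: "?p + ?a + ?b = 0\<^sub>v ?n"
    using z by (auto simp: qp_feas_def pseudograd_def)
  have pc: "?p \<in> carrier_vec ?n" and ac: "?a \<in> carrier_vec ?n" and bc: "?b \<in> carrier_vec ?n"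
    using C P by (auto simp: pseudograd_def)
  have A: "?a \<bullet> x' = ?l \<bullet> (ineqA G *\<^sub>v x')"
    using transpose_vec_mult_scalar[OF C(4) x'c P(2)] comm_scalar_prod C P x'c by auto
  have E: "?b \<bullet> x' = ?v \<bullet> (eqE G *\<^sub>v x')"
    using transpose_vec_mult_scalar[OF C(6) x'c P(3)] comm_scalar_prod C P x'c by auto
  have "?p \<bullet> x' + ?a \<bullet> x' + ?b \<bullet> x' = 0"
    using arg_cong[OF stat, of "\<lambda>v. v \<bullet> x'"] pc ac bc x'c
    by (simp add: add_scalar_prod_distrib[of _ ?n])
  moreover have "?a \<bullet> x' \<le> ineqb G \<bullet> ?l"
    using scalar_prod_mono_left[OF P(2) Ax' C(5) l] A comm_scalar_prod[OF P(2) C(5)] by simp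
  moreover have "?b \<bullet> x' = eqe G \<bullet> ?v"
    using E Ex' comm_scalar_prod[OF P(3) C(7)] by simp
  moreover have "?p \<bullet> ?x = ?x \<bullet> (pgFs G *\<^sub>v ?x) + pgf G \<bullet> ?x"
    using C P by (simp add: pgFs_quadratic pseudograd_def add_scalar_prod_distrib[of _ ?n]
        comm_scalar_prod[of ?x ?n])
  moreover have "?p \<bullet> (?x - x') = ?p \<bullet> ?x - ?p \<bullet> x'"
    using pc P x'c by (simp add: scalar_prod_minus_distrib)
  ultimately show ?thesis
    by (simp add: qp_obj_def)
qed

text \<open>Every admissible deviation is itself a point of \<open>feas G\<close>, so the gap bound
  applies to it and controls the gain of each player.\<close>

lemma qp_feas_approx_GNE:
  assumes z: "z \<in> qp_feas G" and le: "qp_obj G z \<le> \<epsilon>"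
  shows "approx_GNE G \<epsilon> (xpart G z)"
  unfolding approx_GNE_def
proof (intro conjI allI impI ballI)
  show "xpart G z \<in> feas G"
    using z by (auto simp: feas_def qp_feas_def part_carriers)
next
  fix i u assume "i < players G" "deviate G i u (xpart G z) \<in> feas G"
  then show "cost G i (xpart G z) \<le> cost G i (deviate G i u (xpart G z)) + \<epsilon>"
    using cost_deviate_ge[OF _ part_carriers(1), of i z u] pseudograd_gap_le_qp_obj[OF z] le
    by fastforce
qed


section \<open>Convexity and the prox inequality\<close>

lemma qp_feas_convex:
  assumes v: "v \<in> qp_feas G" and w: "w \<in> qp_feas G" and t: "0 \<le> t" "t \<le> 1"
  shows "(1 - t) \<cdot>\<^sub>v v + t \<cdot>\<^sub>v w \<in> qp_feas G"
proof -
  note C = game_carriers and P = part_carriers[of G v] part_carriers[of G w]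
  have vw: "v \<in> carrier_vec (qp_dim G)" "w \<in> carrier_vec (qp_dim G)"
    using v w by (auto simp: qp_feas_def)
  have At: "transpose_mat (ineqA G) \<in> carrier_mat (tdim G) (num_ineq G)"
    and Et: "transpose_mat (eqE G) \<in> carrier_mat (tdim G) (num_eq G)"
    using C by auto
  have cc: "(1 - t) * p + t * q \<le> r" if "p \<le> r" "q \<le> r" for p q r :: real
    using convex_bound_le[OF that, of "1 - t" t] t by simp
  \<comment> \<open>The constant \<open>pgf G\<close> is split with weights \<open>1 - t\<close> and
    \<open>t\<close>, which sum to 1.\<close>
  have "pgF G *\<^sub>v ((1 - t) \<cdot>\<^sub>v xpart G v + t \<cdot>\<^sub>v xpart G w) + pgf G
      + transpose_mat (ineqA G) *\<^sub>v ((1 - t) \<cdot>\<^sub>v lampart G v + t \<cdot>\<^sub>v lampart G w)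
      + transpose_mat (eqE G) *\<^sub>v ((1 - t) \<cdot>\<^sub>v nupart G v + t \<cdot>\<^sub>v nupart G w)
    = (1 - t) \<cdot>\<^sub>v (pgF G *\<^sub>v xpart G v + pgf G + transpose_mat (ineqA G) *\<^sub>v lampart G v
        + transpose_mat (eqE G) *\<^sub>v nupart G v)
      + t \<cdot>\<^sub>v (pgF G *\<^sub>v xpart G w + pgf G + transpose_mat (ineqA G) *\<^sub>v lampart G w
        + transpose_mat (eqE G) *\<^sub>v nupart G w)"
    unfolding mult_mat_vec_lincomb[OF C(1) P(1,4)] mult_mat_vec_lincomb[OF At P(2,5)]
      mult_mat_vec_lincomb[OF Et P(3,6)]
    using C At Et by (intro eq_vecI) (auto simp: algebra_simps simp del: index_mult_mat_vec)
  also have "\<dots> = 0\<^sub>v (tdim G)"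
    using v w by (auto simp: qp_feas_def intro!: eq_vecI)
  finally have stat: "pgF G *\<^sub>v xpart G ((1 - t) \<cdot>\<^sub>v v + t \<cdot>\<^sub>v w) + pgf G
      + transpose_mat (ineqA G) *\<^sub>v lampart G ((1 - t) \<cdot>\<^sub>v v + t \<cdot>\<^sub>v w)
      + transpose_mat (eqE G) *\<^sub>v nupart G ((1 - t) \<cdot>\<^sub>v v + t \<cdot>\<^sub>v w) = 0\<^sub>v (tdim G)"
    unfolding part_lincomb[OF vw] .
  have "eqE G *\<^sub>v xpart G ((1 - t) \<cdot>\<^sub>v v + t \<cdot>\<^sub>v w) = eqe G"
    unfolding part_lincomb[OF vw] mult_mat_vec_lincomb[OF C(6) P(1,4)]
    using v w C(7) by (auto simp: qp_feas_def algebra_simps intro!: eq_vecI)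
  moreover have "ineqA G *\<^sub>v xpart G ((1 - t) \<cdot>\<^sub>v v + t \<cdot>\<^sub>v w) \<le> ineqb G"
    unfolding part_lincomb[OF vw] mult_mat_vec_lincomb[OF C(4) P(1,4)]
    using v w C(4,5) by (auto simp: qp_feas_def less_eq_vec_def simp del: index_mult_mat_vec intro!: cc)
  moreover have "0\<^sub>v (num_ineq G) \<le> lampart G ((1 - t) \<cdot>\<^sub>v v + t \<cdot>\<^sub>v w)"
    unfolding part_lincomb[OF vw]
    using v w t P by (auto simp: qp_feas_def less_eq_vec_def)
  ultimately show ?thesis
    using stat vw by (simp add: qp_feas_def)
qed

text \<open>Only the quadratic term deviates from linearity, and by monotonicity its defect has the
  favourable sign.\<close>

lemma qp_obj_convex:
  assumes v: "v \<in> carrier_vec (qp_dim G)" and w: "w \<in> carrier_vec (qp_dim G)"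
    and t: "0 \<le> t" "t \<le> 1"
  shows "qp_obj G ((1 - t) \<cdot>\<^sub>v v + t \<cdot>\<^sub>v w) \<le> (1 - t) * qp_obj G v + t * qp_obj G w"
proof -
  note C = game_carriers and P = part_carriers[of G v] part_carriers[of G w]
  have "0 \<le> (xpart G v - xpart G w) \<bullet> (pgFs G *\<^sub>v (xpart G v - xpart G w))"
    using P pgF_nonneg pgFs_quadratic by simp
  then have "0 \<le> t * (1 - t) * ((xpart G v - xpart G w) \<bullet> (pgFs G *\<^sub>v (xpart G v - xpart G w)))"
    using t by simp
  then show ?thesis
    unfolding qp_obj_def part_lincomb[OF v w] quadratic_form_convex_comb[OF C(2) P(1,4)]
      scalar_prod_lincomb(1)[OF C(3) P(1,4)] scalar_prod_lincomb(1)[OF C(5) P(2,5)]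
      scalar_prod_lincomb(1)[OF C(7) P(3,6)]
    by (simp add: algebra_simps)
qed

text \<open>Strong convexity of the proximal term strengthens plain minimality by a squared distance
  from \<open>w\<close>. To obtain it, \<open>w\<close> is compared with the points of the segment
  from \<open>w\<close> to \<open>v\<close>, which are then moved towards \<open>w\<close>.\<close>

lemma prox_inequality:
  assumes prox: "is_prox G g y w" and v: "v \<in> qp_feas G" and y: "y \<in> carrier_vec (qp_dim G)"
    and g: "0 < g"
  shows "qp_obj G w + 1 / (2 * g) * (enorm (v - w))\<^sup>2 \<le> qp_obj G v + 1 / (2 * g) * (enorm (v - y))\<^sup>2"
proof -
  define c where "c = 1 / (2 * g)"
  have c: "0 < c" using g by (simp add: c_def)
  note is_prox_le_c = is_prox_le(2)[OF prox, folded c_def]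
  have w: "w \<in> qp_feas G" by (rule is_prox_le[OF prox v])
  then have vw: "v \<in> carrier_vec (qp_dim G)" "w \<in> carrier_vec (qp_dim G)"
    using v by (auto simp: qp_feas_def)
  have "c * (enorm (v - w))\<^sup>2
      \<le> qp_obj G v + c * (enorm (v - y))\<^sup>2 - qp_obj G w - c * (enorm (w - y))\<^sup>2"
  proof (rule field_le_mult_one_interval)
    fix s :: real assume s: "0 < s" "s < 1"
    let ?u = "s \<cdot>\<^sub>v w + (1 - s) \<cdot>\<^sub>v v"
    have u: "?u \<in> qp_feas G"
      using qp_feas_convex[OF w v, of "1 - s"] s by simp
    have "?u - y = (1 - (1 - s)) \<cdot>\<^sub>v (w - y) + (1 - s) \<cdot>\<^sub>v (v - y)"
      using vw y by (intro eq_vecI) (auto simp: algebra_simps)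
    moreover have "(w - y) - (v - y) = (-1) \<cdot>\<^sub>v (v - w)"
      using vw y by (intro eq_vecI) auto
    ultimately have nrm: "(enorm (?u - y))\<^sup>2 = s * (enorm (w - y))\<^sup>2 + (1 - s) * (enorm (v - y))\<^sup>2
        - (1 - s) * s * (enorm (v - w))\<^sup>2"
      using enorm_convex_comb_sq[of "w - y" "qp_dim G" "v - y" "1 - s"] vw y
      by (simp add: enorm_smult_sq)
    have "qp_obj G w + c * (enorm (w - y))\<^sup>2 \<le> qp_obj G ?u + c * (enorm (?u - y))\<^sup>2"
      by (rule is_prox_le_c[OF u])
    also have "\<dots> \<le> s * qp_obj G w + (1 - s) * qp_obj G v + c * (enorm (?u - y))\<^sup>2"
      using qp_obj_convex[OF vw(2,1), of "1 - s"] s by simp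
    \<comment> \<open>Dividing by \<open>1 - s\<close> leaves a factor \<open>s\<close> on the left,
      which disappears as \<open>s\<close> tends to 1.\<close>
    finally have "(1 - s) * (s * (c * (enorm (v - w))\<^sup>2)) \<le> (1 - s) *
        (qp_obj G v + c * (enorm (v - y))\<^sup>2 - qp_obj G w - c * (enorm (w - y))\<^sup>2)"
      unfolding nrm by (simp add: algebra_simps)
    then show "s * (c * (enorm (v - w))\<^sup>2)
        \<le> qp_obj G v + c * (enorm (v - y))\<^sup>2 - qp_obj G w - c * (enorm (w - y))\<^sup>2"
      using s by (simp add: mult_le_cancel_left_pos)
  qed
  moreover have "0 \<le> c * (enorm (w - y))\<^sup>2"
    using c by simp
  ultimately show ?thesis unfolding c_def[symmetric] by linarith
qed


section \<open>The accelerated rate\<close>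

text \<open>One decrease of the potential. The extrapolated points are written from the older
  iterate, so that both sides are the same expression with the index shifted by one.\<close>

lemma accelerated_step:
  assumes prox: "is_prox G g (z1 + (th * (1 / th0 - 1)) \<cdot>\<^sub>v (z1 - z0)) z2" and g: "0 < g"
    and z0: "z0 \<in> carrier_vec (qp_dim G)" and z1: "z1 \<in> qp_feas G"
    and v: "v \<in> qp_feas G" "qp_obj G v = 0"
    and th: "0 < th" "th \<le> 1" "0 < th0" "th\<^sup>2 = (1 - th) * th0\<^sup>2"
  shows "qp_obj G z2 / th\<^sup>2 + 1 / (2 * g) * (enorm (v - (z1 + (1 / th) \<cdot>\<^sub>v (z2 - z1))))\<^sup>2
    \<le> qp_obj G z1 / th0\<^sup>2 + 1 / (2 * g) * (enorm (v - (z0 + (1 / th0) \<cdot>\<^sub>v (z1 - z0))))\<^sup>2"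
proof -
  define y where "y = z1 + (th * (1 / th0 - 1)) \<cdot>\<^sub>v (z1 - z0)"
  define p where "p = (1 - th) \<cdot>\<^sub>v z1 + th \<cdot>\<^sub>v v"
  define a where "a = v - (z1 + (1 / th) \<cdot>\<^sub>v (z2 - z1))"
  define b where "b = v - (z0 + (1 / th0) \<cdot>\<^sub>v (z1 - z0))"
  have prox: "is_prox G g y z2" using prox by (simp add: y_def)
  have p: "p \<in> qp_feas G"
    unfolding p_def using qp_feas_convex[OF z1 v(1)] th by simp
  have z2: "z2 \<in> qp_feas G" by (rule is_prox_le[OF prox p])
  have c: "z1 \<in> carrier_vec (qp_dim G)" "z2 \<in> carrier_vec (qp_dim G)" "v \<in> carrier_vec (qp_dim G)"
    using z1 z2 v by (auto simp: qp_feas_def)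
  have y: "y \<in> carrier_vec (qp_dim G)"
    using c z0 by (simp add: y_def)
  have pz: "p - z2 = th \<cdot>\<^sub>v a"
    using c z0 th by (intro eq_vecI) (auto simp: p_def a_def field_simps)
  \<comment> \<open>The momentum coefficient in \<open>y\<close> is exactly the one for which
    \<open>p - y\<close> is a multiple of \<open>b\<close>.\<close>
  have py: "p - y = th \<cdot>\<^sub>v b"
    using c z0 th by (intro eq_vecI) (auto simp: p_def b_def y_def field_simps)
  have "qp_obj G z2 + 1 / (2 * g) * (enorm (p - z2))\<^sup>2 \<le> qp_obj G p + 1 / (2 * g) * (enorm (p - y))\<^sup>2"
    by (rule prox_inequality[OF prox p y g])
  \<comment> \<open>Since \<open>v\<close> has value 0, its term in the convexity bound
    vanishes.\<close>
  also have "qp_obj G p \<le> (1 - th) * qp_obj G z1"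
    unfolding p_def using qp_obj_convex[OF c(1,3), of th] th v by simp
  finally have "qp_obj G z2 + th\<^sup>2 * (1 / (2 * g) * (enorm a)\<^sup>2)
      \<le> (1 - th) * qp_obj G z1 + th\<^sup>2 * (1 / (2 * g) * (enorm b)\<^sup>2)"
    unfolding pz py enorm_smult_sq by (simp add: mult_ac)
  \<comment> \<open>The recursion makes \<open>1 - th\<close> equal to
    \<open>th\<^sup>2 / th0\<^sup>2\<close>, so \<open>th\<^sup>2\<close> is a common factor of all
    terms.\<close>
  moreover have "(1 - th) * qp_obj G z1 = th\<^sup>2 * (qp_obj G z1 / th0\<^sup>2)"
    using th by (auto simp: power2_eq_square)
  moreover have "qp_obj G z2 = th\<^sup>2 * (qp_obj G z2 / th\<^sup>2)"
    using th(1) by simp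
  ultimately have "th\<^sup>2 * (qp_obj G z2 / th\<^sup>2 + 1 / (2 * g) * (enorm a)\<^sup>2)
      \<le> th\<^sup>2 * (qp_obj G z1 / th0\<^sup>2 + 1 / (2 * g) * (enorm b)\<^sup>2)"
    unfolding distrib_left by linarith
  then show ?thesis
    using th(1) unfolding a_def[symmetric] b_def[symmetric]
    by (simp only: mult_le_cancel_left_pos zero_less_power)
qed

end

text \<open>With \<open>a\<close> and \<open>b\<close> the inverses of the new and old parameters,
  the recursion reads b^2 = a^2 - a = (a - 1/2)^2 - 1/4, whence b \<le> a - 1/2.\<close>

lemma momentum_inverse_growth:
  fixes \<theta> :: "nat \<Rightarrow> real"
  assumes "\<theta> 0 = 1"
    and "\<And>k. 0 < \<theta> (Suc k) \<and> \<theta> (Suc k) \<le> 1 \<and> (\<theta> (Suc k))\<^sup>2 = (1 - \<theta> (Suc k)) * (\<theta> k)\<^sup>2"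
  shows "real (k + 2) / 2 \<le> 1 / \<theta> k"
proof (induction k)
  case 0
  then show ?case using assms by simp
next
  case (Suc k)
  let ?a = "1 / \<theta> (Suc k)" and ?b = "1 / \<theta> k"
  have pos: "0 < \<theta> k" using assms by (cases k) auto
  have th: "0 < \<theta> (Suc k)" "\<theta> (Suc k) \<le> 1" "(\<theta> (Suc k))\<^sup>2 = (1 - \<theta> (Suc k)) * (\<theta> k)\<^sup>2"
    using assms(2)[of k] by auto
  have a: "1 \<le> ?a" using th by simp
  have "(1 / \<theta> k)\<^sup>2 = (1 - \<theta> (Suc k)) / (\<theta> (Suc k))\<^sup>2"
    \<comment> \<open>The value 1 is impossible: the recursion would give 1 = 0.\<close>
    using th pos by (cases "\<theta> (Suc k) = 1") (simp_all add: power_divide)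
  also have "\<dots> = ?a\<^sup>2 - ?a"
    using th by (simp add: field_simps power2_eq_square)
  finally have "?b\<^sup>2 \<le> (?a - 1 / 2)\<^sup>2"
    by (simp add: power2_eq_square algebra_simps)
  then have "?b \<le> ?a - 1 / 2"
    by (rule power2_le_imp_le) (use a in linarith)
  with Suc show ?case by (simp add: field_simps)
qed

theorem proposition4p3:
  fixes G :: lq_game
    and zstar :: "real vec"
    and \<gamma> :: real
    and \<theta> :: "nat \<Rightarrow> real"
    and y z :: "nat \<Rightarrow> real vec"
  assumes "wf_lq_game G"
    and "monotone_pseudograd G"
    and "qp_solution G zstar" and "qp_obj G zstar = 0"
    and "\<gamma> > 0"
    and "accel_ppa G (\<lambda>_. \<gamma>) \<theta> y z"
  shows "\<exists>C\<ge>0. \<forall>k\<ge>1. approx_GNE G (C / (real k)\<^sup>2) (xpart G (z k))"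
proof -
  note wm = assms(1,2)
  define D where "D = 1 / (2 * \<gamma>) * (enorm (zstar - z 0))\<^sup>2"
  \<comment> \<open>Written with \<open>z k\<close> and \<open>z (Suc k)\<close>, this is the
    auxiliary point of index k + 1 in the overview.\<close>
  define u where "u k = z k + (1 / \<theta> k) \<cdot>\<^sub>v (z (Suc k) - z k)" for k
  have star: "zstar \<in> qp_feas G"
    using assms(3) by (simp add: qp_solution_def is_arg_min_def)
  have z0: "z 0 \<in> carrier_vec (qp_dim G)" and th0: "\<theta> 0 = 1" and prox0: "is_prox G \<gamma> (z 0) (z 1)"
    using assms(6) by (auto simp: accel_ppa_def)
  have step: "0 < \<theta> (Suc k)" "\<theta> (Suc k) \<le> 1" "(\<theta> (Suc k))\<^sup>2 = (1 - \<theta> (Suc k)) * (\<theta> k)\<^sup>2"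
    "is_prox G \<gamma> (z (Suc k) + (\<theta> (Suc k) * (1 / \<theta> k - 1)) \<cdot>\<^sub>v (z (Suc k) - z k)) (z (Suc (Suc k)))" for k
  proof -
    have "0 < \<theta> (Suc k) \<and> \<theta> (Suc k) \<le> 1 \<and>
        (\<theta> (Suc k))\<^sup>2 / \<gamma> = (1 - \<theta> (Suc k)) * (\<theta> (Suc k - 1))\<^sup>2 / \<gamma> \<and>
        y (Suc k) = z (Suc k) + (\<theta> (Suc k) * (1 / \<theta> (Suc k - 1) - 1)) \<cdot>\<^sub>v (z (Suc k) - z (Suc k - 1)) \<and>
        is_prox G \<gamma> (y (Suc k)) (z (Suc k + 1))"
      using assms(6) unfolding accel_ppa_def by (metis le_add1 plus_1_eq_Suc)
    then show "0 < \<theta> (Suc k)" "\<theta> (Suc k) \<le> 1" "(\<theta> (Suc k))\<^sup>2 = (1 - \<theta> (Suc k)) * (\<theta> k)\<^sup>2"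
      "is_prox G \<gamma> (z (Suc k) + (\<theta> (Suc k) * (1 / \<theta> k - 1)) \<cdot>\<^sub>v (z (Suc k) - z k)) (z (Suc (Suc k)))"
      using assms(5) by auto
  qed
  have pos: "0 < \<theta> k" for k
    using th0 step(1) by (cases k) auto
  \<comment> \<open>The starting point \<open>z 0\<close> may be infeasible, so feasibility and the
    potential start at \<open>z 1\<close>.\<close>
  have feas: "z (Suc k) \<in> qp_feas G" for k
    using is_prox_le(1)[OF prox0 star] is_prox_le(1)[OF step(4) star] by (cases k) auto
  have carr: "z k \<in> carrier_vec (qp_dim G)" for k
    using z0 feas by (cases k) (auto simp: qp_feas_def)
  have potential: "qp_obj G (z (Suc k)) / (\<theta> k)\<^sup>2 + 1 / (2 * \<gamma>) * (enorm (zstar - u k))\<^sup>2 \<le> D" for k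
  proof (induction k)
    case 0
    \<comment> \<open>Because \<open>\<theta> 0 = 1\<close>, the base case is a single prox
      inequality tested at \<open>zstar\<close>.\<close>
    have "u 0 = z 1"
      using carr[of 0] carr[of 1] th0 by (intro eq_vecI) (auto simp: u_def)
    then show ?case
      using prox_inequality[OF wm prox0 star z0 assms(5)] th0 assms(4) by (simp add: D_def)
  next
    case (Suc k)
    show ?case
      using accelerated_step[OF wm step(4) assms(5) carr feas star assms(4) step(1,2) pos step(3)] Suc
      unfolding u_def by (rule order_trans)
  qed
  have D: "0 \<le> D" using assms(5) by (simp add: D_def)
  have rate: "qp_obj G (z (Suc k)) \<le> 4 * D / (real (Suc k))\<^sup>2" for k
  proof -
    have "qp_obj G (z (Suc k)) / (\<theta> k)\<^sup>2 \<le> D"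
      using potential[of k] assms(5) by (smt (verit) divide_nonneg_nonneg mult_nonneg_nonneg zero_le_power2)
    then have "qp_obj G (z (Suc k)) \<le> D * (\<theta> k)\<^sup>2"
      using pos[of k] by (simp add: divide_le_eq)
    \<comment> \<open>The growth lemma gives the bound 2/(k + 2), weakened to match the iterate
      index; its square produces the constant 4.\<close>
    also have "\<theta> k \<le> 2 / real (Suc k)"
      using momentum_inverse_growth[of \<theta> k] th0 step(1-3) pos[of k] by (simp add: field_simps)
    then have "D * (\<theta> k)\<^sup>2 \<le> D * (2 / real (Suc k))\<^sup>2"
      using D pos[of k] by (intro mult_left_mono power_mono) auto
    finally show ?thesis by (simp add: power_divide mult_ac)
  qed
  have "approx_GNE G (4 * D / (real k)\<^sup>2) (xpart G (z k))" if "k \<ge> 1" for k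
    using that qp_feas_approx_GNE[OF wm feas rate, of "k - 1"] by simp
  with D show ?thesis
    by (intro exI[of _ "4 * D"]) simp
qed

end
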